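(* Let $K\ge1$ and $L>2K$. Let $h_\ell=\sum_{k=0}^{K-1}\eta_k\beta_k^\ell$, $\ell=0,\dots,L-1$, with non-zero coefficients $\eta_k\in\mathbb{C}$ and pairwise distinct non-zero bases $\beta_k\in\mathbb{C}$, and let $\tilde h_\ell=h_\ell+e_\ell$ with $|h_\ell-\tilde h_\ell|\le\epsilon$. Put $H:=(h_{\ell+k})_{\ell,k=0}^{L-K-1,K}$, $E:=(e_{\ell+k})_{\ell,k=0}^{L-K-1,K}$ and $\tilde H:=H+E$. Let $\tilde\gamma=(\tilde\gamma_k)_{k=0}^K$ be a normalized right singular vector to the smallest singular value $\tilde\sigma_K$ of $\tilde H$, and let $\sigma_{K-1}$ be the smallest non-zero singular value of $H$. Then the polynomial $\tilde P(z)=\sum_{k=0}^K\tilde\gamma_kz^k$ satisfies $$\sum_{k=0}^{K-1}|\tilde P(\beta_k)|^2\le KL\,\rho_\beta^{2L-2}\;\frac{\bigl(\tilde\sigma_K+\|E\|_2\bigr)^2}{\sigma_{K-1}^2}.$$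
   Context: $\|E\|_2$ is the spectral norm; "normalized" means Euclidean norm one; an $(L-K)\times(K+1)$ matrix with $L>2K$ has $K+1$ singular values (counted with multiplicity). $\beta=(\beta_k)_{k=0}^{K-1}$ and $\rho_\beta:=\max\{1,\|\beta\|_\infty\}=\max\{1,\max_k|\beta_k|\}$. *)

theory Defs
  imports
    "Jordan_Normal_Form.Schur_Decomposition"
    "HOL-Computational_Algebra.Computational_Algebra"
    Complex_Main
begin

definition euclid_norm :: "complex vec \<Rightarrow> real" where
  "euclid_norm v = sqrt (\<Sum>i<dim_vec v. (cmod (v $ i))\<^sup>2)"

(* Operator norm induced by the Euclidean norms; to be used for matrices with at least one
   column, otherwise the supremum ranges over the empty set. *)
definition spectral_norm :: "complex mat \<Rightarrow> real" where
  "spectral_norm A =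
    (SUP v \<in> {v \<in> carrier_vec (dim_col A). euclid_norm v = 1}. euclid_norm (A *\<^sub>v v))"

(* The min m n singular values of an m x n matrix, counted with multiplicity: the square roots
   of the (real, nonnegative) eigenvalues of A^* A or A A^*, whichever product is smaller. *)
definition singular_values :: "complex mat \<Rightarrow> real multiset" where
  "singular_values A =
    image_mset (\<lambda>z. sqrt (Re z))
      (proots (char_poly
        (if dim_col A \<le> dim_row A then mat_adjoint A * A else A * mat_adjoint A)))"

definition smallest_singular_value :: "complex mat \<Rightarrow> real" where
  "smallest_singular_value A = Min (set_mset (singular_values A))"

definition smallest_nonzero_singular_value :: "complex mat \<Rightarrow> real" where
  "smallest_nonzero_singular_value A = Min {s. s \<in># singular_values A \<and> s \<noteq> 0}"

(* Not normalized: any nonzero v that, together with a left singular vector u of the same norm,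
   satisfies A v = s u and A^* u = s v. *)
definition right_singular_vector :: "complex mat \<Rightarrow> real \<Rightarrow> complex vec \<Rightarrow> bool" where
  "right_singular_vector A s v \<longleftrightarrow>
    s \<ge> 0 \<and> v \<in> carrier_vec (dim_col A) \<and> v \<noteq> 0\<^sub>v (dim_col A) \<and>
    (\<exists>u \<in> carrier_vec (dim_row A). euclid_norm u = euclid_norm v \<and>
      A *\<^sub>v v = complex_of_real s \<cdot>\<^sub>v u \<and>
      mat_adjoint A *\<^sub>v u = complex_of_real s \<cdot>\<^sub>v v)"

definition hankel_mat :: "nat \<Rightarrow> nat \<Rightarrow> (nat \<Rightarrow> complex) \<Rightarrow> complex mat" where
  "hankel_mat m n x = mat m n (\<lambda>(l, k). x (l + k))"

definition rho :: "nat \<Rightarrow> (nat \<Rightarrow> complex) \<Rightarrow> real" where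
  "rho K \<beta> = max 1 (Max ((\<lambda>k. cmod (\<beta> k)) ` {..<K}))"

end

theory Submission
  imports Defs "HOL-Analysis.L2_Norm"
begin

text \<open>Split the approximate singular vector as \<open>\<gamma> = a + c\<close>, with \<open>a\<close> in the kernel of \<open>H\<close> and \<open>c\<close> in
  the sum of the eigenspaces of \<open>H\<^sup>* H\<close> for non-zero eigenvalues. The Vandermonde
  factorisation of \<open>H\<close> shows that the polynomial of \<open>a\<close> vanishes at every \<open>\<beta>\<^sub>k\<close>, so
  only \<open>c\<close> contributes to the values \<open>P(\<beta>\<^sub>k)\<close>, and Cauchy--Schwarz bounds these by the norm of \<open>c\<close>.
  Orthogonality of the eigenspaces gives \<open>\<sigma> \<parallel>c\<parallel> \<le> \<parallel>H \<gamma>\<parallel> \<le> \<parallel>H' \<gamma>\<parallel> + \<parallel>E \<gamma>\<parallel> \<le> \<sigma>' + \<parallel>E\<parallel>\<close>.\<close>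

(* Otherwise $ is ambiguous between vec_index and fps_nth. *)
unbundle no Formal_Power_Series.fps_syntax

section \<open>Hermitian inner product and adjoint\<close>

lemma euclid_norm_nonneg: "0 \<le> euclid_norm v"
  unfolding euclid_norm_def by (simp add: sum_nonneg)

lemma euclid_norm_eq_L2_set: "euclid_norm v = L2_set (\<lambda>i. cmod (v $ i)) {..<dim_vec v}"
  unfolding euclid_norm_def L2_set_def ..

lemma euclid_norm_add_le:
  assumes "v \<in> carrier_vec n" "w \<in> carrier_vec n"
  shows "euclid_norm (v + w) \<le> euclid_norm v + euclid_norm w"
proof -
  have "euclid_norm (v + w) \<le> L2_set (\<lambda>i. cmod (v $ i) + cmod (w $ i)) {..<n}"
    unfolding euclid_norm_eq_L2_set using assms
    by (auto intro!: L2_set_mono simp: norm_triangle_ineq)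
  also have "\<dots> \<le> euclid_norm v + euclid_norm w"
    unfolding euclid_norm_eq_L2_set using assms by (auto intro: L2_set_triangle_ineq)
  finally show ?thesis .
qed

lemma euclid_norm_smult: "euclid_norm (a \<cdot>\<^sub>v v) = cmod a * euclid_norm v"
  unfolding euclid_norm_eq_L2_set
  by (simp add: L2_set_right_distrib norm_mult cong: L2_set_cong_simp)

lemma cscalar_prod_self:
  fixes v :: "complex vec"
  shows "v \<bullet>c v = complex_of_real ((euclid_norm v)\<^sup>2)"
  unfolding euclid_norm_def scalar_prod_def
  by (simp add: sum_nonneg complex_norm_square atLeast0LessThan del: of_real_power)

lemma euclid_norm_eq_0_iff: "v \<in> carrier_vec n \<Longrightarrow> euclid_norm v = 0 \<longleftrightarrow> v = 0\<^sub>v n"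
  using conjugate_square_eq_0_vec[of v n] by (simp add: cscalar_prod_self)

lemma mat_adjoint_conv:
  "mat_adjoint A = mat (dim_col A) (dim_row A) (\<lambda>(i, j). conjugate (A $$ (j, i)))"
  by (rule eq_matI) (auto simp: mat_adjoint_def mat_of_rows_def)

lemma mat_adjoint_carrier: "A \<in> carrier_mat m n \<Longrightarrow> mat_adjoint A \<in> carrier_mat n m"
  unfolding mat_adjoint_conv by auto

lemma mult_mat_vec_cscalar_prod:
  fixes A :: "complex mat"
  assumes "A \<in> carrier_mat m n" "v \<in> carrier_vec n" "w \<in> carrier_vec m"
  shows "(A *\<^sub>v v) \<bullet>c w = v \<bullet>c (mat_adjoint A *\<^sub>v w)"
proof -
  have "(A *\<^sub>v v) \<bullet>c w = (\<Sum>i<m. \<Sum>j<n. A $$ (i, j) * v $ j * cnj (w $ i))"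
    using assms by (auto simp: scalar_prod_def sum_distrib_right atLeast0LessThan intro!: sum.cong)
  also have "\<dots> = (\<Sum>j<n. \<Sum>i<m. A $$ (i, j) * v $ j * cnj (w $ i))"
    by (rule sum.swap)
  also have "\<dots> = v \<bullet>c (mat_adjoint A *\<^sub>v w)"
    using assms
    by (auto simp: scalar_prod_def sum_distrib_left atLeast0LessThan mat_adjoint_conv mult_ac
        intro!: sum.cong)
  finally show ?thesis .
qed

text \<open>The adjoint moves across the inner product. With \<open>v = w\<close> this turns
  statements about eigenvalues of the Gram matrix into statements about the norm of
  \<open>A v\<close>.\<close>

lemma gram_cscalar_prod:
  fixes A :: "complex mat"
  assumes A: "A \<in> carrier_mat m n" and v: "v \<in> carrier_vec n" and w: "w \<in> carrier_vec n"
  shows "(mat_adjoint A * A *\<^sub>v v) \<bullet>c w = (A *\<^sub>v v) \<bullet>c (A *\<^sub>v w)"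
proof -
  note A' = mat_adjoint_carrier[OF A]
  have "mat_adjoint (mat_adjoint A) = A"
    by (rule eq_matI) (auto simp: mat_adjoint_conv)
  then show ?thesis
    using mult_mat_vec_cscalar_prod[OF A', of "A *\<^sub>v v" w] A A' v w by simp
qed

section \<open>Eigenspace decomposition of Hermitian matrices\<close>

text \<open>The dimension is explicit, so the empty sum is the zero vector of dimension
  \<open>n\<close> and the result always lies in the carrier.\<close>

definition vsum :: "nat \<Rightarrow> 'b set \<Rightarrow> ('b \<Rightarrow> complex vec) \<Rightarrow> complex vec" where
  "vsum n S f = vec n (\<lambda>i. \<Sum>x\<in>S. f x $ i)"

lemma vsum_carrier [simp]: "vsum n S f \<in> carrier_vec n"
  unfolding vsum_def by simp

lemma mult_mat_vec_vsum:
  assumes "A \<in> carrier_mat m n" "\<And>x. x \<in> S \<Longrightarrow> f x \<in> carrier_vec n"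
  shows "A *\<^sub>v vsum n S f = vsum m S (\<lambda>x. A *\<^sub>v f x)"
proof (rule eq_vecI)
  fix i assume "i < dim_vec (vsum m S (\<lambda>x. A *\<^sub>v f x))"
  then have i: "i < m" by (simp add: vsum_def)
  have "(A *\<^sub>v vsum n S f) $ i = (\<Sum>j<n. \<Sum>x\<in>S. A $$ (i, j) * f x $ j)"
    using assms i by (simp add: scalar_prod_def sum_distrib_left atLeast0LessThan vsum_def)
  also have "\<dots> = (\<Sum>x\<in>S. \<Sum>j<n. A $$ (i, j) * f x $ j)"
    by (rule sum.swap)
  also have "\<dots> = vsum m S (\<lambda>x. A *\<^sub>v f x) $ i"
    using assms i by (force simp: scalar_prod_def atLeast0LessThan vsum_def intro!: sum.cong)
  finally show "(A *\<^sub>v vsum n S f) $ i = vsum m S (\<lambda>x. A *\<^sub>v f x) $ i" .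
qed (use assms in \<open>simp add: vsum_def\<close>)

lemma vsum_cscalar_prod:
  assumes "\<And>x. x \<in> S \<Longrightarrow> f x \<in> carrier_vec n" "w \<in> carrier_vec n"
  shows "vsum n S f \<bullet>c w = (\<Sum>x\<in>S. f x \<bullet>c w)"
proof -
  have "vsum n S f \<bullet>c w = (\<Sum>j<n. \<Sum>x\<in>S. f x $ j * cnj (w $ j))"
    using assms by (simp add: scalar_prod_def sum_distrib_right atLeast0LessThan vsum_def)
  also have "\<dots> = (\<Sum>x\<in>S. \<Sum>j<n. f x $ j * cnj (w $ j))"
    by (rule sum.swap)
  also have "\<dots> = (\<Sum>x\<in>S. f x \<bullet>c w)"
    using assms by (auto simp: scalar_prod_def atLeast0LessThan intro!: sum.cong)
  finally show ?thesis .
qed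

lemma cscalar_prod_vsum:
  assumes "\<And>x. x \<in> S \<Longrightarrow> f x \<in> carrier_vec n" "w \<in> carrier_vec n"
  shows "w \<bullet>c vsum n S f = (\<Sum>x\<in>S. w \<bullet>c f x)"
proof -
  have "w \<bullet>c vsum n S f = (\<Sum>j<n. \<Sum>x\<in>S. w $ j * cnj (f x $ j))"
    using assms by (simp add: scalar_prod_def sum_distrib_left atLeast0LessThan vsum_def)
  also have "\<dots> = (\<Sum>x\<in>S. \<Sum>j<n. w $ j * cnj (f x $ j))"
    by (rule sum.swap)
  also have "\<dots> = (\<Sum>x\<in>S. w \<bullet>c f x)"
    using assms by (force simp: scalar_prod_def atLeast0LessThan intro!: sum.cong)
  finally show ?thesis .
qed

text \<open>Zero vectors are allowed: \<open>f x\<close> stands for the component in the eigenspace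
  of \<open>x\<close>, which may vanish, so a single index set \<open>S\<close> serves for all
  vectors.\<close>

definition eigenfamily :: "nat \<Rightarrow> complex mat \<Rightarrow> complex set \<Rightarrow> (complex \<Rightarrow> complex vec) \<Rightarrow> bool"
  where "eigenfamily n M S f \<longleftrightarrow> (\<forall>x\<in>S. f x \<in> carrier_vec n \<and> M *\<^sub>v f x = x \<cdot>\<^sub>v f x)"

text \<open>Moving \<open>M\<close> across the inner product of \<open>v\<close> and
  \<open>w\<close> multiplies it by \<open>x\<close> on one side and by \<open>cnj y\<close> on the
  other. Keeping the conjugate in the assumption allows \<open>v = w\<close>, which yields the
  reality of eigenvalues.\<close>

lemma hermitian_eigenvectors_orthogonal:
  fixes M :: "complex mat"
  assumes M: "M \<in> carrier_mat n n" and herm: "mat_adjoint M = M"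
    and v: "v \<in> carrier_vec n" "M *\<^sub>v v = x \<cdot>\<^sub>v v"
    and w: "w \<in> carrier_vec n" "M *\<^sub>v w = y \<cdot>\<^sub>v w"
    and ne: "x \<noteq> cnj y"
  shows "v \<bullet>c w = 0"
proof -
  have "x * (v \<bullet>c w) = (M *\<^sub>v v) \<bullet>c w"
    using v w by simp
  also have "\<dots> = v \<bullet>c (M *\<^sub>v w)"
    using mult_mat_vec_cscalar_prod[OF M v(1) w(1)] herm by simp
  also have "\<dots> = cnj y * (v \<bullet>c w)"
    using v w by (simp add: conjugate_smult_vec)
  finally show ?thesis
    using ne by (simp add: algebra_simps)
qed

text \<open>Otherwise the eigenvector would be orthogonal to itself.\<close>

lemma hermitian_eigenvalue_real:
  fixes M :: "complex mat"
  assumes M: "M \<in> carrier_mat n n" and herm: "mat_adjoint M = M"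
    and v: "v \<in> carrier_vec n" "M *\<^sub>v v = x \<cdot>\<^sub>v v" "v \<noteq> 0\<^sub>v n"
  shows "cnj x = x"
proof (rule ccontr)
  assume "cnj x \<noteq> x"
  then have "v \<bullet>c v = 0"
    using hermitian_eigenvectors_orthogonal[OF M herm v(1,2) v(1,2)] by metis
  then show False using v by simp
qed

text \<open>A Hermitian matrix has no generalised eigenvectors: the component of the right-hand side
  in the eigenspace of \<open>e\<close> is both in the kernel and in the range of \<open>M - e\<close>, hence zero,
  and on the other eigenspaces \<open>M - e\<close> is inverted explicitly.\<close>

lemma eigenfamily_step:
  fixes M :: "complex mat"
  assumes M: "M \<in> carrier_mat n n" and herm: "mat_adjoint M = M"
    and S: "finite S" "e \<in> S" and f: "eigenfamily n M S f"
    and v: "v \<in> carrier_vec n" and Mv: "M *\<^sub>v v = e \<cdot>\<^sub>v v + vsum n S f"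
  shows "\<exists>g. eigenfamily n M S g \<and> v = vsum n S g"
proof -
  have fc: "x \<in> S \<Longrightarrow> f x \<in> carrier_vec n" and fe: "x \<in> S \<Longrightarrow> M *\<^sub>v f x = x \<cdot>\<^sub>v f x" for x
    using f unfolding eigenfamily_def by auto
  \<comment> \<open>On the eigenspace of \<open>x\<close>, \<open>M - e\<close> is multiplication by
    \<open>x - e\<close>, so \<open>u x\<close> is a preimage of \<open>f x\<close>. At
    \<open>x = e\<close> division by zero gives a zero vector, but \<open>e\<close> is removed from
    every sum over \<open>u\<close>.\<close>
  define u where "u x = (1 / (x - e)) \<cdot>\<^sub>v f x" for x
  define w where "w = v - vsum n (S - {e}) u"
  have uc: "x \<in> S \<Longrightarrow> u x \<in> carrier_vec n" for x
    unfolding u_def using fc by simp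
  have wc: "w \<in> carrier_vec n" unfolding w_def using v by simp
  have ue: "M *\<^sub>v u x = x \<cdot>\<^sub>v u x" if "x \<in> S" for x
    unfolding u_def using fe[OF that] fc[OF that] M
    by (simp add: mult_mat_vec[OF M] smult_smult_assoc mult.commute)
  have Mu: "M *\<^sub>v vsum n (S - {e}) u = vsum n (S - {e}) (\<lambda>x. x \<cdot>\<^sub>v u x)"
    using mult_mat_vec_vsum[OF M, of "S - {e}" u] uc ue by (simp add: vsum_def)
  have Mw: "M *\<^sub>v w = e \<cdot>\<^sub>v w + f e"
  proof (rule eq_vecI)
    fix i assume "i < dim_vec (e \<cdot>\<^sub>v w + f e)"
    then have i: "i < n" using fc[OF S(2)] by simp
    have Mw_eq: "M *\<^sub>v w = M *\<^sub>v v - M *\<^sub>v vsum n (S - {e}) u"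
      unfolding w_def using M v by (simp add: mult_minus_distrib_mat_vec)
    have Fi: "(\<Sum>x\<in>S. f x $ i) = f e $ i + (\<Sum>x\<in>S - {e}. f x $ i)"
      using S by (simp add: sum.remove)
    have "(\<Sum>x\<in>S - {e}. (x \<cdot>\<^sub>v u x) $ i) = (\<Sum>x\<in>S - {e}. f x $ i + e * u x $ i)"
    proof (rule sum.cong)
      fix x assume x: "x \<in> S - {e}"
      then have "dim_vec (f x) = n" using fc by auto
      then show "(x \<cdot>\<^sub>v u x) $ i = f x $ i + e * u x $ i"
        unfolding u_def using x i by (auto simp: field_simps)
    qed simp
    then have U: "(\<Sum>x\<in>S - {e}. (x \<cdot>\<^sub>v u x) $ i)
        = (\<Sum>x\<in>S - {e}. f x $ i) + e * (\<Sum>x\<in>S - {e}. u x $ i)"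
      by (simp add: sum.distrib sum_distrib_left)
    show "(M *\<^sub>v w) $ i = (e \<cdot>\<^sub>v w + f e) $ i"
      unfolding Mw_eq Mv Mu using i v fc[OF S(2)] U Fi
      by (simp add: w_def vsum_def algebra_simps)
  qed (use M fc[OF S(2)] in simp)
  have fe0: "f e = 0\<^sub>v n"
  proof (rule ccontr)
    assume nz: "f e \<noteq> 0\<^sub>v n"
    note F = fc[OF S(2)] fe[OF S(2)]
    \<comment> \<open>Since \<open>f e\<close> is an eigenvector, \<open>e\<close> is real and can
      be pulled out of either argument. Pairing \<open>Mw\<close> with \<open>f e\<close> then
      cancels everything but the square of the norm of \<open>f e\<close>.\<close>
    have real: "cnj e = e"
      using hermitian_eigenvalue_real[OF M herm F nz] .
    have "e * (w \<bullet>c f e) + f e \<bullet>c f e = (M *\<^sub>v w) \<bullet>c f e"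
      using Mw wc F by (simp add: add_scalar_prod_distrib[of _ n])
    also have "\<dots> = w \<bullet>c (e \<cdot>\<^sub>v f e)"
      using mult_mat_vec_cscalar_prod[OF M wc F(1)] F herm by simp
    also have "\<dots> = e * (w \<bullet>c f e)"
      using wc F real by (simp add: conjugate_smult_vec)
    finally have "f e \<bullet>c f e = 0" by simp
    with nz F show False by simp
  qed
  define g where "g x = (if x = e then w else u x)" for x
  have "M *\<^sub>v w = e \<cdot>\<^sub>v w" using Mw fe0 wc by simp
  then have "eigenfamily n M S g"
    unfolding eigenfamily_def g_def using wc uc ue by auto
  moreover have "v = vsum n S g"
  proof (rule eq_vecI)
    fix i assume "i < dim_vec (vsum n S g)"
    then have i: "i < n" by (simp add: vsum_def)
    have "(\<Sum>x\<in>S. g x $ i) = w $ i + (\<Sum>x\<in>S - {e}. u x $ i)"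
      using S by (simp add: sum.remove g_def)
    then show "v $ i = vsum n S g $ i"
      using i v by (simp add: vsum_def w_def)
  qed (use v in \<open>simp add: vsum_def\<close>)
  ultimately show ?thesis by blast
qed

text \<open>Linear combinations are formed separately in each eigenspace. Only columns with a
  non-zero coefficient have to be decomposed, which lets an induction over the columns use the
  earlier ones alone.\<close>

lemma eigenfamily_mult_mat_vec:
  fixes M P :: "complex mat" and a :: "complex vec"
  assumes M: "M \<in> carrier_mat n n" and P: "P \<in> carrier_mat n m" and a: "a \<in> carrier_vec m"
    and cols: "\<And>j. j < m \<Longrightarrow> a $ j \<noteq> 0 \<Longrightarrow> \<exists>f. eigenfamily n M S f \<and> col P j = vsum n S f"
  shows "\<exists>f. eigenfamily n M S f \<and> P *\<^sub>v a = vsum n S f"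
proof -
  obtain F where F: "\<And>j. j < m \<Longrightarrow> a $ j \<noteq> 0 \<Longrightarrow> eigenfamily n M S (F j) \<and> col P j = vsum n S (F j)"
    using cols by metis
  define J where "J = {j. j < m \<and> a $ j \<noteq> 0}"
  define f where "f x = vsum n J (\<lambda>j. a $ j \<cdot>\<^sub>v F j x)" for x
  have FJ: "j \<in> J \<Longrightarrow> x \<in> S \<Longrightarrow> F j x \<in> carrier_vec n \<and> M *\<^sub>v F j x = x \<cdot>\<^sub>v F j x" for j x
    using F unfolding J_def eigenfamily_def by blast
  have "eigenfamily n M S f"
    unfolding eigenfamily_def
  proof (intro ballI conjI)
    fix x assume x: "x \<in> S"
    show "f x \<in> carrier_vec n" unfolding f_def by simp
    have "M *\<^sub>v f x = vsum n J (\<lambda>j. M *\<^sub>v (a $ j \<cdot>\<^sub>v F j x))"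
      unfolding f_def using FJ x by (intro mult_mat_vec_vsum[OF M]) auto
    also have "\<dots> = vsum n J (\<lambda>j. x \<cdot>\<^sub>v (a $ j \<cdot>\<^sub>v F j x))"
      unfolding vsum_def using FJ x
      by (auto intro!: eq_vecI sum.cong simp: mult_mat_vec[OF M] smult_smult_assoc mult.commute)
    also have "\<dots> = x \<cdot>\<^sub>v f x"
      unfolding f_def vsum_def using FJ x
      by (intro eq_vecI) (force simp: sum_distrib_left intro!: sum.cong)+
    finally show "M *\<^sub>v f x = x \<cdot>\<^sub>v f x" .
  qed
  moreover have "P *\<^sub>v a = vsum n S f"
  proof (rule eq_vecI)
    fix i assume "i < dim_vec (vsum n S f)"
    then have i: "i < n" by (simp add: vsum_def)
    have "(P *\<^sub>v a) $ i = (\<Sum>j<m. P $$ (i, j) * a $ j)"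
      using i P a by (simp add: scalar_prod_def atLeast0LessThan)
    also have "\<dots> = (\<Sum>j\<in>J. P $$ (i, j) * a $ j)"
      unfolding J_def by (rule sum.mono_neutral_right) auto
    also have "\<dots> = (\<Sum>j\<in>J. \<Sum>x\<in>S. a $ j * F j x $ i)"
    proof (rule sum.cong)
      fix j assume j: "j \<in> J"
      then have "col P j = vsum n S (F j)" using F unfolding J_def by auto
      then have "col P j $ i = (\<Sum>x\<in>S. F j x $ i)" using i by (simp add: vsum_def)
      then show "P $$ (i, j) * a $ j = (\<Sum>x\<in>S. a $ j * F j x $ i)"
        using i j P by (simp add: J_def sum_distrib_left mult.commute)
    qed simp
    also have "\<dots> = (\<Sum>x\<in>S. \<Sum>j\<in>J. a $ j * F j x $ i)" by (rule sum.swap)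
    also have "\<dots> = vsum n S f $ i"
      unfolding f_def vsum_def using i FJ by (force intro!: sum.cong)
    finally show "(P *\<^sub>v a) $ i = vsum n S f $ i" .
  qed (use P in \<open>simp add: vsum_def\<close>)
  ultimately show ?thesis by blast
qed

text \<open>Every column of the matrix triangularising \<open>M\<close> is a sum of eigenvectors, by induction on
  its index.\<close>

lemma hermitian_eigenfamily:
  fixes M :: "complex mat"
  assumes M: "M \<in> carrier_mat n n" and herm: "mat_adjoint M = M" and v: "v \<in> carrier_vec n"
  shows "\<exists>f. eigenfamily n M {x. eigenvalue M x} f \<and> v = vsum n {x. eigenvalue M x} f"
proof -
  let ?S = "{x. eigenvalue M x}"
  have roots: "?S = {x. poly (char_poly M) x = 0}"
    using eigenvalue_root_char_poly[OF M] by simp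
  have "char_poly M \<noteq> 0"
    using degree_monic_char_poly[OF M] by auto
  then have fin: "finite ?S" unfolding roots by (rule poly_roots_finite)
  obtain es where es: "char_poly M = (\<Prod>a\<leftarrow>es. [:- a, 1:])"
    using char_poly_factorized[OF M] by blast
  obtain B P Q where "schur_decomposition M es = (B, P, Q)"
    by (cases "schur_decomposition M es") auto
  from schur_decomposition[OF M es this]
  have sim: "similar_mat_wit M B P Q" and ut: "upper_triangular B" and dg: "diag_mat B = es"
    by auto
  note D = similar_mat_witD2[OF M sim]
  have MP: "M * P = P * B"
  proof -
    have "M * P = P * B * (Q * P)" using D by (simp add: assoc_mult_mat[of _ n n _ n _ n])
    then show ?thesis using D by simp
  qed
  have col: "\<exists>f. eigenfamily n M ?S f \<and> col P j = vsum n ?S f" if "j < n" for j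
    using that
  proof (induction j rule: less_induct)
    case (less j)
    define e where "e = B $$ (j, j)"
    have "e \<in> set es" unfolding dg[symmetric] e_def diag_mat_def using D less.prems by auto
    then have e: "e \<in> ?S" unfolding roots es by (auto simp: poly_prod_list prod_list_zero_iff)
    \<comment> \<open>The part of column \<open>j\<close> of \<open>B\<close> above the diagonal.
      Column \<open>j\<close> of \<open>M P = P B\<close> then says that \<open>M - e\<close> maps
      \<open>col P j\<close> to \<open>P a\<close>, a combination of earlier columns.\<close>
    define a where "a = vec n (\<lambda>i. if i < j then B $$ (i, j) else 0)"
    have a: "a \<in> carrier_vec n" unfolding a_def by simp
    have "\<exists>f. eigenfamily n M ?S f \<and> P *\<^sub>v a = vsum n ?S f"
    proof (rule eigenfamily_mult_mat_vec[OF M D(6) a])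
      fix i assume "i < n" "a $ i \<noteq> 0"
      then have "i < j" by (simp add: a_def split: if_splits)
      then show "\<exists>f. eigenfamily n M ?S f \<and> col P i = vsum n ?S f"
        using less.IH less.prems by simp
    qed
    then obtain f where f: "eigenfamily n M ?S f" "P *\<^sub>v a = vsum n ?S f"
      by blast
    have colB: "col B j = e \<cdot>\<^sub>v unit_vec n j + a"
    proof (rule eq_vecI)
      fix i assume "i < dim_vec (e \<cdot>\<^sub>v unit_vec n j + a)"
      then have i: "i < n" by (simp add: a_def)
      show "col B j $ i = (e \<cdot>\<^sub>v unit_vec n j + a) $ i"
        using i less.prems D ut
        by (cases i j rule: linorder_cases) (auto simp: a_def e_def)
    qed (use D in \<open>simp add: a_def\<close>)
    have unit: "P *\<^sub>v unit_vec n j = col P j"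
      using D(6) less.prems by (intro eq_vecI) auto
    have "M *\<^sub>v col P j = P *\<^sub>v col B j"
      using arg_cong[OF MP, of "\<lambda>X. col X j"]
      unfolding col_mult2[OF M D(6) less.prems] col_mult2[OF D(6,5) less.prems] .
    also have "\<dots> = e \<cdot>\<^sub>v col P j + vsum n ?S f"
      unfolding colB f(2)[symmetric] using D(6) less.prems a
      by (simp add: mult_add_distrib_mat_vec[of _ n n] mult_mat_vec[of _ n n] unit)
    finally show ?case
      using D less.prems by (intro eigenfamily_step[OF M herm fin e f(1)]) auto
  qed
  \<comment> \<open>As \<open>P Q = 1\<close>, \<open>v\<close> is the combination of the columns of
    \<open>P\<close> with coefficients \<open>Q v\<close>.\<close>
  have "v = (P * Q) *\<^sub>v v" using D(1) v by simp
  also have "\<dots> = P *\<^sub>v (Q *\<^sub>v v)" using D(6,7) v by (rule assoc_mult_mat_vec)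
  finally show ?thesis
    using eigenfamily_mult_mat_vec[OF M D(6), of "Q *\<^sub>v v" ?S] col D v by simp
qed

section \<open>Singular values\<close>

text \<open>The eigenvalue equals the Rayleigh quotient, the squared norm of \<open>A v\<close>
  divided by that of \<open>v\<close>.\<close>

lemma gram_eigenvalue_nonneg:
  fixes A :: "complex mat"
  assumes A: "A \<in> carrier_mat m n" and v: "v \<in> carrier_vec n" "v \<noteq> 0\<^sub>v n"
    and ev: "mat_adjoint A * A *\<^sub>v v = x \<cdot>\<^sub>v v"
  shows "x = complex_of_real (Re x)" "0 \<le> Re x"
proof -
  let ?a = "(euclid_norm v)\<^sup>2" and ?b = "(euclid_norm (A *\<^sub>v v))\<^sup>2"
  have "x * complex_of_real ?a = complex_of_real ?b"
    using gram_cscalar_prod[OF A v(1) v(1)] v(1)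
    unfolding cscalar_prod_self[symmetric] by (simp add: ev)
  moreover have a: "0 < ?a"
    using v euclid_norm_eq_0_iff by simp
  ultimately have "x = complex_of_real (?b / ?a)"
    by (simp add: nonzero_eq_divide_eq)
  then show "x = complex_of_real (Re x)" "0 \<le> Re x" by simp_all
qed

text \<open>\<open>n \<le> m\<close> selects the Gram matrix on the column side. Multiplicities are
  dropped, since the minimum defining \<open>\<sigma>\<close> depends on the set only.\<close>

lemma set_singular_values:
  assumes A: "A \<in> carrier_mat m n" and le: "n \<le> m"
  shows "set_mset (singular_values A) = (\<lambda>z. sqrt (Re z)) ` {z. eigenvalue (mat_adjoint A * A) z}"
proof -
  have G: "mat_adjoint A * A \<in> carrier_mat n n"
    using mult_carrier_mat[OF mat_adjoint_carrier[OF A] A] .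
  have "char_poly (mat_adjoint A * A) \<noteq> 0"
    using degree_monic_char_poly[OF G] by auto
  then show ?thesis
    unfolding singular_values_def using A le eigenvalue_root_char_poly[OF G] by simp
qed

lemma singular_values_nonneg:
  assumes A: "A \<in> carrier_mat m n" and le: "n \<le> m" and s: "s \<in># singular_values A"
  shows "0 \<le> s"
proof -
  obtain z where z: "eigenvalue (mat_adjoint A * A) z" "s = sqrt (Re z)"
    using s set_singular_values[OF A le] by auto
  then obtain v where "eigenvector (mat_adjoint A * A) v z"
    unfolding eigenvalue_def by blast
  then have "0 \<le> Re z"
    using A mat_adjoint_carrier[OF A]
    by (intro gram_eigenvalue_nonneg(2)[OF A, of v]) (auto simp: eigenvector_def)
  then show ?thesis using z by simp
qed

text \<open>If \<open>A = 0\<close>, then \<open>\<sigma>\<close> is the minimum of the empty set, but in that case \<open>c\<close> vanishes.\<close>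

lemma kernel_decomposition:
  fixes A :: "complex mat"
  assumes A: "A \<in> carrier_mat m n" and le: "n \<le> m" and v: "v \<in> carrier_vec n"
  defines "\<sigma> \<equiv> smallest_nonzero_singular_value A"
  obtains a c where "a \<in> carrier_vec n" "c \<in> carrier_vec n" "v = a + c" "A *\<^sub>v a = 0\<^sub>v m"
    "(euclid_norm c)\<^sup>2 \<le> (euclid_norm (A *\<^sub>v v))\<^sup>2 / \<sigma>\<^sup>2"
proof -
  define M where "M = mat_adjoint A * A"
  have M: "M \<in> carrier_mat n n" unfolding M_def using mult_carrier_mat[OF mat_adjoint_carrier[OF A] A] .
  have herm: "mat_adjoint M = M"
  proof (rule eq_matI)
    fix i j assume "i < dim_row M" "j < dim_col M"
    then have ij: "i < n" "j < n" using M by auto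
    have *: "M $$ (k, l) = (\<Sum>r<m. cnj (A $$ (r, k)) * A $$ (r, l))" if "k < n" "l < n" for k l
      unfolding M_def using A that
      by (simp add: mat_adjoint_conv scalar_prod_def atLeast0LessThan)
    show "mat_adjoint M $$ (i, j) = M $$ (i, j)"
      using ij M by (simp add: mat_adjoint_conv * mult.commute)
  qed (use M in \<open>auto simp: mat_adjoint_conv\<close>)
  let ?S = "{x. eigenvalue M x}"
  have "char_poly M \<noteq> 0" using degree_monic_char_poly[OF M] by auto
  then have fin: "finite ?S"
    using eigenvalue_root_char_poly[OF M] poly_roots_finite by simp
  obtain f where f: "eigenfamily n M ?S f" "v = vsum n ?S f"
    using hermitian_eigenfamily[OF M herm v] by blast
  have fc: "f x \<in> carrier_vec n" and fe: "M *\<^sub>v f x = x \<cdot>\<^sub>v f x" if "x \<in> ?S" for x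
    using f that unfolding eigenfamily_def by auto
  define T where "T = ?S - {0}"
  \<comment> \<open>The intersection is \<open>{0}\<close> or empty, so \<open>a\<close> is zero
    when 0 is not an eigenvalue.\<close>
  define a where "a = vsum n (?S \<inter> {0}) f"
  define c where "c = vsum n T f"
  have ac: "a \<in> carrier_vec n" "c \<in> carrier_vec n" unfolding a_def c_def by simp_all
  have vac: "v = a + c"
  proof (rule eq_vecI)
    fix i assume "i < dim_vec (a + c)"
    then have i: "i < n" using ac by simp
    have "(\<Sum>x\<in>?S. f x $ i) = (\<Sum>x\<in>?S \<inter> {0}. f x $ i) + (\<Sum>x\<in>T. f x $ i)"
      unfolding T_def using fin by (rule sum.Int_Diff)
    then show "v $ i = (a + c) $ i"
      using i by (simp add: f(2) a_def c_def vsum_def)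
  qed (use f ac in \<open>simp add: vsum_def\<close>)
  have "M *\<^sub>v a = vsum n (?S \<inter> {0}) (\<lambda>x. M *\<^sub>v f x)"
    unfolding a_def using fc by (intro mult_mat_vec_vsum[OF M]) auto
  also have "\<dots> = 0\<^sub>v n"
    unfolding vsum_def using fe fc by (fastforce intro!: eq_vecI sum.neutral)
  finally have "(A *\<^sub>v a) \<bullet>c (A *\<^sub>v a) = 0"
    using gram_cscalar_prod[OF A ac(1) ac(1)] ac unfolding M_def by simp
  then have Aa: "A *\<^sub>v a = 0\<^sub>v m"
    using A ac conjugate_square_eq_0_vec[of "A *\<^sub>v a" m] by simp
  \<comment> \<open>Orthogonality needs \<open>x \<noteq> cnj y\<close>. A non-zero
    \<open>f y\<close> makes \<open>y\<close> real, so that \<open>x \<noteq> y\<close> suffices; a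
    zero \<open>f y\<close> is trivial.\<close>
  have orth: "f x \<bullet>c f y = 0" if xy: "x \<in> T" "y \<in> T" "x \<noteq> y" for x y
  proof (cases "f y = 0\<^sub>v n")
    case True
    then show ?thesis using xy fc[of x] unfolding T_def by simp
  next
    case False
    have "cnj y = y"
      using hermitian_eigenvalue_real[OF M herm _ _ False] fc fe xy unfolding T_def by simp
    then show ?thesis
      using hermitian_eigenvectors_orthogonal[OF M herm, of "f x" x "f y" y] fc fe xy
      unfolding T_def by simp
  qed
  have fT: "f x \<in> carrier_vec n" "M *\<^sub>v f x = x \<cdot>\<^sub>v f x" if "x \<in> T" for x
    using fc fe that unfolding T_def by auto
  have finT: "finite T" unfolding T_def using fin by simp
  have fxc: "f x \<bullet>c c = f x \<bullet>c f x" if "x \<in> T" for x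
  proof -
    have "f x \<bullet>c c = (\<Sum>y\<in>T. f x \<bullet>c f y)"
      unfolding c_def using fT that by (intro cscalar_prod_vsum) auto
    also have "\<dots> = (\<Sum>y\<in>{x}. f x \<bullet>c f y)"
      using that finT orth by (intro sum.mono_neutral_right) auto
    finally show ?thesis by simp
  qed
  have "c \<bullet>c c = (\<Sum>x\<in>T. f x \<bullet>c c)"
    unfolding c_def using fT by (intro vsum_cscalar_prod) auto
  also have "\<dots> = (\<Sum>x\<in>T. complex_of_real ((euclid_norm (f x))\<^sup>2))"
    using fxc by (simp add: cscalar_prod_self)
  finally have norm_c: "(euclid_norm c)\<^sup>2 = (\<Sum>x\<in>T. (euclid_norm (f x))\<^sup>2)"
    unfolding cscalar_prod_self of_real_sum[symmetric] of_real_eq_iff .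
  have Avc: "A *\<^sub>v v = A *\<^sub>v c"
    unfolding vac using A ac Aa by (simp add: mult_add_distrib_mat_vec[OF A])
  have ev: "x = complex_of_real (Re x)" "0 \<le> Re x" if "x \<in> T" "f x \<noteq> 0\<^sub>v n" for x
    using gram_eigenvalue_nonneg[OF A fT(1)[OF that(1)] that(2)] fT(2)[OF that(1)]
    unfolding M_def by blast+
  \<comment> \<open>The squared norm of \<open>A v\<close> is the Pythagorean sum for
    \<open>c\<close> with weights \<open>Re x\<close>. Each weight belonging to a non-zero
    \<open>f x\<close> is the square of a non-zero singular value, so the two sums can be compared
    termwise.\<close>
  have "(A *\<^sub>v c) \<bullet>c (A *\<^sub>v c) = (M *\<^sub>v c) \<bullet>c c"
    using gram_cscalar_prod[OF A ac(2) ac(2)] unfolding M_def by simp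
  also have "M *\<^sub>v c = vsum n T (\<lambda>x. x \<cdot>\<^sub>v f x)"
    unfolding c_def using mult_mat_vec_vsum[OF M, of T f] fT by (simp add: vsum_def)
  also have "\<dots> \<bullet>c c = (\<Sum>x\<in>T. (x \<cdot>\<^sub>v f x) \<bullet>c c)"
    using fT ac by (intro vsum_cscalar_prod) auto
  also have "\<dots> = (\<Sum>x\<in>T. complex_of_real (Re x * (euclid_norm (f x))\<^sup>2))"
  proof (rule sum.cong)
    fix x assume x: "x \<in> T"
    have "(x \<cdot>\<^sub>v f x) \<bullet>c c = x * complex_of_real ((euclid_norm (f x))\<^sup>2)"
      using fT[OF x] ac fxc[OF x] by (simp add: cscalar_prod_self)
    also have "\<dots> = complex_of_real (Re x * (euclid_norm (f x))\<^sup>2)"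
    proof (cases "f x = 0\<^sub>v n")
      case True
      then have "euclid_norm (f x) = 0" using euclid_norm_eq_0_iff fT[OF x] by blast
      then show ?thesis by simp
    next
      case False
      show ?thesis using ev(1)[OF x False] by (metis of_real_mult)
    qed
    finally show "(x \<cdot>\<^sub>v f x) \<bullet>c c = complex_of_real (Re x * (euclid_norm (f x))\<^sup>2)" .
  qed simp
  finally have norm_Av: "(euclid_norm (A *\<^sub>v v))\<^sup>2 = (\<Sum>x\<in>T. Re x * (euclid_norm (f x))\<^sup>2)"
    unfolding Avc cscalar_prod_self of_real_sum[symmetric] of_real_eq_iff .
  have "(euclid_norm c)\<^sup>2 \<le> (euclid_norm (A *\<^sub>v v))\<^sup>2 / \<sigma>\<^sup>2"
  proof (cases "\<forall>x\<in>T. f x = 0\<^sub>v n")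
    case True
    then have "(euclid_norm c)\<^sup>2 = 0"
      unfolding norm_c using euclid_norm_eq_0_iff[of "0\<^sub>v n" n] by simp
    then show ?thesis by simp
  next
    case False
    let ?N = "{s. s \<in># singular_values A \<and> s \<noteq> 0}"
    have finN: "finite ?N" by simp
    have inN: "sqrt (Re x) \<in> ?N" if "x \<in> T" "f x \<noteq> 0\<^sub>v n" for x
    proof -
      have "Re x \<noteq> 0" using ev[OF that] that(1) unfolding T_def by (metis DiffE of_real_0 singletonI)
      moreover have "sqrt (Re x) \<in># singular_values A"
        using set_singular_values[OF A le] that(1) unfolding T_def M_def by auto
      ultimately show ?thesis by simp
    qed
    \<comment> \<open>A non-zero component provides an element, so the minimum is attained and
      \<open>\<sigma>\<close> is a genuine positive singular value.\<close>
    then have "?N \<noteq> {}" using False by blast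
    then have "\<sigma> \<in> ?N"
      unfolding \<sigma>_def smallest_nonzero_singular_value_def using finN Min_in by blast
    then have pos: "0 < \<sigma>"
      using singular_values_nonneg[OF A le] by force
    have "\<sigma>\<^sup>2 * (euclid_norm (f x))\<^sup>2 \<le> Re x * (euclid_norm (f x))\<^sup>2" if x: "x \<in> T" for x
    proof (cases "f x = 0\<^sub>v n")
      case True
      then have "euclid_norm (f x) = 0" using euclid_norm_eq_0_iff fT[OF x] by blast
      then show ?thesis by simp
    next
      case False
      have "\<sigma> \<le> sqrt (Re x)"
        unfolding \<sigma>_def smallest_nonzero_singular_value_def
        using finN inN[OF x False] by (rule Min_le)
      then have "\<sigma>\<^sup>2 \<le> Re x"
        using pos ev(2)[OF x False] real_le_rsqrt sqrt_le_D
        by (metis abs_of_nonneg less_imp_le real_sqrt_abs real_sqrt_le_iff)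
      then show ?thesis by (simp add: mult_right_mono)
    qed
    then have "\<sigma>\<^sup>2 * (euclid_norm c)\<^sup>2 \<le> (euclid_norm (A *\<^sub>v v))\<^sup>2"
      unfolding norm_c norm_Av sum_distrib_left by (rule sum_mono)
    then show ?thesis using pos by (simp add: field_simps)
  qed
  with ac vac Aa that show ?thesis by blast
qed

text \<open>A real supremum dominates its members only if the set is bounded; the sum of the moduli
  of all entries is a crude bound on the unit sphere.\<close>

lemma euclid_norm_le_spectral_norm:
  assumes A: "A \<in> carrier_mat m n" and v: "v \<in> carrier_vec n" "euclid_norm v = 1"
  shows "euclid_norm (A *\<^sub>v v) \<le> spectral_norm A"
  unfolding spectral_norm_def
proof (rule cSUP_upper)
  show "v \<in> {v \<in> carrier_vec (dim_col A). euclid_norm v = 1}" using A v by simp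
  show "bdd_above ((\<lambda>v. euclid_norm (A *\<^sub>v v)) ` {v \<in> carrier_vec (dim_col A). euclid_norm v = 1})"
  proof (rule bdd_aboveI2)
    fix w assume "w \<in> {v \<in> carrier_vec (dim_col A). euclid_norm v = 1}"
    then have w: "w \<in> carrier_vec n" "euclid_norm w = 1" using A by auto
    have w1: "cmod (w $ j) \<le> 1" if "j < n" for j
      using member_le_L2_set[of "{..<dim_vec w}" j "\<lambda>i. cmod (w $ i)"] w that
      by (simp add: euclid_norm_eq_L2_set)
    have "euclid_norm (A *\<^sub>v w) \<le> (\<Sum>i<m. cmod ((A *\<^sub>v w) $ i))"
      unfolding euclid_norm_eq_L2_set using A
      by (simp add: L2_set_le_sum del: index_mult_mat_vec)
    also have "\<dots> \<le> (\<Sum>i<m. \<Sum>j<n. cmod (A $$ (i, j)))"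
    proof (rule sum_mono)
      fix i assume "i \<in> {..<m}"
      then have "cmod ((A *\<^sub>v w) $ i) = cmod (\<Sum>j<n. A $$ (i, j) * w $ j)"
        using A w by (simp add: scalar_prod_def atLeast0LessThan)
      also have "\<dots> \<le> (\<Sum>j<n. cmod (A $$ (i, j)))"
        using w1 by (intro sum_norm_le) (simp add: norm_mult mult_left_le)
      finally show "cmod ((A *\<^sub>v w) $ i) \<le> (\<Sum>j<n. cmod (A $$ (i, j)))" .
    qed
    finally show "euclid_norm (A *\<^sub>v w) \<le> (\<Sum>i<m. \<Sum>j<n. cmod (A $$ (i, j)))" .
  qed
qed

section \<open>Hankel matrices of exponential sums\<close>

text \<open>Test against the polynomial vanishing at all nodes but the \<open>k\<close>-th.\<close>

lemma vandermonde_kernel_trivial: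
  fixes \<beta> w :: "nat \<Rightarrow> complex"
  assumes inj: "inj_on \<beta> {..<K}" and z: "\<And>l. l < K \<Longrightarrow> (\<Sum>k<K. w k * \<beta> k ^ l) = 0"
    and k: "k < K"
  shows "w k = 0"
proof -
  define q where "q = (\<Prod>j\<in>{..<K} - {k}. [:- \<beta> j, 1:])"
  \<comment> \<open>With \<open>K - 1\<close> factors, \<open>q\<close> involves only powers below
    \<open>K\<close>, exactly those covered by \<open>z\<close>.\<close>
  have "degree q < K"
    unfolding q_def using k by (subst degree_prod_sum_eq) auto
  then have q: "poly q x = (\<Sum>l<K. coeff q l * x ^ l)" for x
    unfolding poly_altdef by (intro sum.mono_neutral_left) (auto simp: coeff_eq_0)
  have "0 = (\<Sum>l<K. coeff q l * (\<Sum>i<K. w i * \<beta> i ^ l))"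
    using z by simp
  also have "\<dots> = (\<Sum>i<K. \<Sum>l<K. coeff q l * (w i * \<beta> i ^ l))"
    unfolding sum_distrib_left by (rule sum.swap)
  also have "\<dots> = (\<Sum>i<K. w i * poly q (\<beta> i))"
    unfolding q sum_distrib_left by (simp add: mult.left_commute)
  also have "\<dots> = (\<Sum>i\<in>{k}. w i * poly q (\<beta> i))"
    using k by (intro sum.mono_neutral_right) (auto simp: q_def poly_prod)
  finally have "w k * poly q (\<beta> k) = 0" by simp
  moreover have "poly q (\<beta> k) \<noteq> 0"
    using inj k by (auto simp: q_def poly_prod inj_on_def)
  ultimately show ?thesis by simp
qed

text \<open>The first \<open>K\<close> rows of the Hankel system form a Vandermonde system whose
  unknowns are \<open>\<eta> k\<close> times the value at \<open>\<beta> k\<close> of the polynomial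
  with coefficients \<open>a\<close>.\<close>

lemma hankel_kernel_roots:
  fixes \<eta> \<beta> h :: "nat \<Rightarrow> complex"
  assumes inj: "inj_on \<beta> {..<K}" and \<eta>: "\<And>k. k < K \<Longrightarrow> \<eta> k \<noteq> 0" and m: "K \<le> m"
    and h: "\<And>l. l < m + n - 1 \<Longrightarrow> h l = (\<Sum>k<K. \<eta> k * \<beta> k ^ l)"
    and a: "a \<in> carrier_vec n" "hankel_mat m n h *\<^sub>v a = 0\<^sub>v m" and k: "k < K"
  shows "(\<Sum>j<n. a $ j * \<beta> k ^ j) = 0"
proof -
  have "\<eta> k * (\<Sum>j<n. a $ j * \<beta> k ^ j) = 0"
  proof (rule vandermonde_kernel_trivial[OF inj _ k, where w = "\<lambda>k. \<eta> k * (\<Sum>j<n. a $ j * \<beta> k ^ j)"])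
    fix l assume l: "l < K"
    have "(\<Sum>k<K. \<eta> k * (\<Sum>j<n. a $ j * \<beta> k ^ j) * \<beta> k ^ l)
        = (\<Sum>k<K. \<Sum>j<n. \<eta> k * \<beta> k ^ (l + j) * a $ j)"
      by (simp add: sum_distrib_left sum_distrib_right power_add mult_ac)
    also have "\<dots> = (\<Sum>j<n. \<Sum>k<K. \<eta> k * \<beta> k ^ (l + j) * a $ j)"
      by (rule sum.swap)
    \<comment> \<open>For \<open>l < K \<le> m\<close> and \<open>j < n\<close> the index
      \<open>l + j\<close> is at most \<open>m + n - 2\<close>, within the range of
      \<open>h\<close>.\<close>
    also have "\<dots> = (\<Sum>j<n. h (l + j) * a $ j)"
      using l m by (auto simp: h sum_distrib_right intro!: sum.cong)
    also have "\<dots> = (hankel_mat m n h *\<^sub>v a) $ l"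
      using l m a(1) by (simp add: hankel_mat_def scalar_prod_def atLeast0LessThan)
    also have "\<dots> = 0" using a(2) l m by (simp del: index_mult_mat_vec)
    finally show "(\<Sum>k<K. \<eta> k * (\<Sum>j<n. a $ j * \<beta> k ^ j) * \<beta> k ^ l) = 0" .
  qed
  then show ?thesis using \<eta>[OF k] by simp
qed

text \<open>As \<open>1 \<le> r\<close>, every power of \<open>z\<close> is bounded by the top power
  of \<open>r\<close>; Cauchy--Schwarz against this constant sequence contributes the factor
  \<open>n\<close>.\<close>

lemma cmod_polynomial_value_le:
  assumes c: "c \<in> carrier_vec n" and z: "cmod z \<le> r" "1 \<le> r"
  shows "(cmod (\<Sum>j<n. c $ j * z ^ j))\<^sup>2 \<le> real n * r ^ (2 * (n - 1)) * (euclid_norm c)\<^sup>2"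
proof -
  have "cmod (\<Sum>j<n. c $ j * z ^ j) \<le> (\<Sum>j<n. \<bar>cmod (c $ j)\<bar> * \<bar>r ^ (n - 1)\<bar>)"
  proof (rule sum_norm_le)
    fix j assume j: "j \<in> {..<n}"
    have "cmod z ^ j \<le> r ^ j" using z by (intro power_mono) auto
    also have "\<dots> \<le> r ^ (n - 1)" using z j by (intro power_increasing) auto
    finally show "cmod (c $ j * z ^ j) \<le> \<bar>cmod (c $ j)\<bar> * \<bar>r ^ (n - 1)\<bar>"
      using z by (simp add: norm_mult norm_power mult_left_mono)
  qed
  also have "\<dots> \<le> L2_set (\<lambda>j. cmod (c $ j)) {..<n} * L2_set (\<lambda>j. r ^ (n - 1)) {..<n}"
    by (rule L2_set_mult_ineq)
  also have "\<dots> = euclid_norm c * (sqrt (real n) * r ^ (n - 1))"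
    using c z by (simp add: euclid_norm_eq_L2_set L2_set_constant)
  finally have "(cmod (\<Sum>j<n. c $ j * z ^ j))\<^sup>2 \<le> (euclid_norm c * (sqrt (real n) * r ^ (n - 1)))\<^sup>2"
    by (intro power_mono) auto
  then show ?thesis by (simp add: power_mult_distrib power_mult mult_ac power_commutes flip: power_mult)
qed

section \<open>Perturbation bound for the polynomial values at the nodes\<close>

theorem theorem9p5:
  fixes K L :: nat
    and \<eta> \<beta> h h' e :: "nat \<Rightarrow> complex"
    and \<epsilon> \<sigma> \<sigma>' :: real
    and H E H' :: "complex mat"
    and \<gamma> :: "complex vec"
    and P :: "complex poly"
  assumes "K \<ge> 1" and "L > 2 * K"
    and "\<And>k. k < K \<Longrightarrow> \<eta> k \<noteq> 0"
    and "\<And>k. k < K \<Longrightarrow> \<beta> k \<noteq> 0"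
    and "inj_on \<beta> {..<K}"
    and "\<And>l. l < L \<Longrightarrow> h l = (\<Sum>k<K. \<eta> k * \<beta> k ^ l)"
    and "\<And>l. l < L \<Longrightarrow> h' l = h l + e l"
    and "\<And>l. l < L \<Longrightarrow> cmod (h l - h' l) \<le> \<epsilon>"
    and "H = hankel_mat (L - K) (K + 1) h"
    and "E = hankel_mat (L - K) (K + 1) e"
    and "H' = H + E"
    and "\<sigma>' = smallest_singular_value H'"
    and "\<sigma> = smallest_nonzero_singular_value H"
    and "right_singular_vector H' \<sigma>' \<gamma>" and "euclid_norm \<gamma> = 1"
    and "P = (\<Sum>k\<le>K. monom (\<gamma> $ k) k)"
  shows "(\<Sum>k<K. (cmod (poly P (\<beta> k)))\<^sup>2)
    \<le> real K * real L * rho K \<beta> ^ (2 * L - 2) * ((\<sigma>' + spectral_norm E)\<^sup>2 / \<sigma>\<^sup>2)"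
proof -
  let ?m = "L - K" and ?n = "K + 1"
  note K = assms(1) and L = assms(2) and h = assms(6)
  have H: "H \<in> carrier_mat ?m ?n" and E: "E \<in> carrier_mat ?m ?n"
    unfolding assms by (simp_all add: hankel_mat_def)
  have \<gamma>: "\<gamma> \<in> carrier_vec ?n"
    using assms(14) E unfolding right_singular_vector_def assms(11) by simp
  \<comment> \<open>The left singular vector inherits norm one from \<open>\<gamma>\<close>, so
    \<open>H' \<gamma>\<close> has norm exactly \<open>\<sigma>'\<close>.\<close>
  obtain u where u: "0 \<le> \<sigma>'" "euclid_norm u = 1" "H' *\<^sub>v \<gamma> = complex_of_real \<sigma>' \<cdot>\<^sub>v u"
    using assms(14,15) unfolding right_singular_vector_def by auto
  have "H *\<^sub>v \<gamma> = H' *\<^sub>v \<gamma> + (- 1) \<cdot>\<^sub>v (E *\<^sub>v \<gamma>)"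
    unfolding assms(11) using H E \<gamma> by (auto simp: add_mult_distrib_mat_vec[OF H E])
  then have "euclid_norm (H *\<^sub>v \<gamma>) \<le> euclid_norm (H' *\<^sub>v \<gamma>) + euclid_norm ((- 1) \<cdot>\<^sub>v (E *\<^sub>v \<gamma>))"
    using euclid_norm_add_le[of "H' *\<^sub>v \<gamma>" ?m "(- 1) \<cdot>\<^sub>v (E *\<^sub>v \<gamma>)"]
      mult_mat_vec_carrier[OF add_carrier_mat[OF E, of H] \<gamma>] mult_mat_vec_carrier[OF E \<gamma>]
    by (simp add: assms(11))
  also have "\<dots> = \<sigma>' + euclid_norm (E *\<^sub>v \<gamma>)"
    using u by (simp add: euclid_norm_smult)
  also have "\<dots> \<le> \<sigma>' + spectral_norm E"
    using euclid_norm_le_spectral_norm[OF E \<gamma> assms(15)] by simp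
  finally have residual: "euclid_norm (H *\<^sub>v \<gamma>) \<le> \<sigma>' + spectral_norm E" .
  obtain a c where a: "a \<in> carrier_vec ?n" and c: "c \<in> carrier_vec ?n" and \<gamma>ac: "\<gamma> = a + c"
    and Ha: "H *\<^sub>v a = 0\<^sub>v ?m"
    and norm_c: "(euclid_norm c)\<^sup>2 \<le> (euclid_norm (H *\<^sub>v \<gamma>))\<^sup>2 / \<sigma>\<^sup>2"
  proof (rule kernel_decomposition[OF H _ \<gamma>])
    show "?n \<le> ?m" using L by simp
  qed (use assms(13) in blast)
  note norm_c
  also have "(euclid_norm (H *\<^sub>v \<gamma>))\<^sup>2 / \<sigma>\<^sup>2 \<le> (\<sigma>' + spectral_norm E)\<^sup>2 / \<sigma>\<^sup>2"
    using residual by (intro divide_right_mono power_mono) (auto simp: euclid_norm_nonneg)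
  finally have bound_c: "(euclid_norm c)\<^sup>2 \<le> (\<sigma>' + spectral_norm E)\<^sup>2 / \<sigma>\<^sup>2" .
  have \<rho>1: "1 \<le> rho K \<beta>" unfolding rho_def by simp
  have "(cmod (poly P (\<beta> k)))\<^sup>2
      \<le> real L * rho K \<beta> ^ (2 * L - 2) * ((\<sigma>' + spectral_norm E)\<^sup>2 / \<sigma>\<^sup>2)" if k: "k < K" for k
  proof -
    have \<rho>: "cmod (\<beta> k) \<le> rho K \<beta>"
      unfolding rho_def using k by (intro max.coboundedI2 Max_ge) auto
    \<comment> \<open>The matrix sizes satisfy \<open>(L - K) + (K + 1) - 1 = L\<close>, so the
      Hankel matrix uses exactly the given samples; \<open>L > 2 * K\<close> supplies the required
      \<open>K\<close> rows.\<close>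
    have "(\<Sum>j<?n. a $ j * \<beta> k ^ j) = 0"
      using L h k a Ha unfolding assms(9)
      by (intro hankel_kernel_roots[OF assms(5,3), where m = "L - K" and n = "K + 1" and h = h]) auto
    then have "poly P (\<beta> k) = (\<Sum>j<?n. c $ j * \<beta> k ^ j)"
      unfolding assms(16) using a c
      by (simp add: \<gamma>ac poly_sum poly_monom sum.distrib distrib_right flip: lessThan_Suc_atMost
          del: sum.lessThan_Suc)
    then have "(cmod (poly P (\<beta> k)))\<^sup>2 \<le> real ?n * rho K \<beta> ^ (2 * K) * (euclid_norm c)\<^sup>2"
      using cmod_polynomial_value_le[OF c \<rho> \<rho>1] by simp
    \<comment> \<open>\<open>K + 1 \<le> L\<close> and \<open>2 * K \<le> 2 * L - 2\<close> relax
      the constants to those of the claim; \<open>\<rho>1\<close> makes the power monotone in its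
      exponent.\<close>
    also have "\<dots> \<le> real L * rho K \<beta> ^ (2 * L - 2) * ((\<sigma>' + spectral_norm E)\<^sup>2 / \<sigma>\<^sup>2)"
      using K L \<rho>1 bound_c by (intro mult_mono power_increasing) auto
    finally show ?thesis .
  qed
  then have "(\<Sum>k<K. (cmod (poly P (\<beta> k)))\<^sup>2)
      \<le> real (card {..<K}) * (real L * rho K \<beta> ^ (2 * L - 2) * ((\<sigma>' + spectral_norm E)\<^sup>2 / \<sigma>\<^sup>2))"
    by (intro sum_bounded_above) simp
  then show ?thesis by (simp add: mult.assoc)
qed

end
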